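(* Let $\mathcal{A}$ be a complex unital Banach algebra with involution $*$, and let $a,w\in\mathcal{A}$. Then the following are equivalent: (1) $a$ is a generalized $w$-EP element. (2) $a$ has a generalized $w$-Drazin inverse $a^{d,w}$, and $a^{d,w}$ is a $w$-EP element. In this case, if $x$ is a generalized $w$-EP inverse of $a$, then $(aw)^2x$ is a $w$-EP inverse of $a^{d,w}$; and if $y$ is a $w$-EP inverse of $a^{d,w}$, then $(a^{d,w}w)^2y$ is a generalized $w$-EP inverse of $a$.
   Context: An involution is a conjugate-linear map $*$ with $(xy)^*=y^*x^*$ and $x^{**}=x$. An element $u\in\mathcal{A}$ is quasinilpotent if $\lim_{n\to\infty}\|u^n\|^{1/n}=0$. A $w$-EP inverse of $a$ is an $x\in\mathcal{A}$ with $a(wx)^2=x$, $x(wa)^2=a$, $(awxw)^*=awxw$, $(xwaw)^*=xwaw$; $a$ is a $w$-EP element if such $x$ exists. A generalized $w$-EP inverse of $a$ is an $x\in\mathcal{A}$ with $a(wx)^2=x$, $(awxw)^*=awxw$, $(xwaw)^*=xwaw$ and $\lim_{n\to\infty}\|(aw)^n-xw(aw)^{n+1}\|^{1/n}=0$; $a$ is a generalized $w$-EP element if such $x$ exists. A generalized $w$-Drazin inverse of $a$ is an $x\in\mathcal{A}$ with $awx=xwa$, $xwawx=x$ and $(a-awxwa)w$ quasinilpotent; it is unique when it exists and is denoted $a^{d,w}$. *)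

theory Defs
  imports Complex_Main
begin

text \<open>
  Complex unital Banach algebras, as an extension of the real ones from the library
  (complete, submultiplicative norm, \<^prop>\<open>norm 1 = 1\<close>): the complex scalar multiplication
  extends the real one and is compatible with the product and the norm.
\<close>

class complex_banach_algebra_1 = real_normed_algebra_1 + banach +
  fixes scaleC :: "complex \<Rightarrow> 'a \<Rightarrow> 'a"  (infixr "*\<^sub>C" 75)
  assumes scaleC_of_real: "complex_of_real r *\<^sub>C x = r *\<^sub>R x"
    and scaleC_add_right: "c *\<^sub>C (x + y) = c *\<^sub>C x + c *\<^sub>C y"
    and scaleC_add_left: "(c + d) *\<^sub>C x = c *\<^sub>C x + d *\<^sub>C x"
    and scaleC_scaleC: "c *\<^sub>C (d *\<^sub>C x) = (c * d) *\<^sub>C x"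
    and mult_scaleC_left: "(c *\<^sub>C x) * y = c *\<^sub>C (x * y)"
    and mult_scaleC_right: "x * (c *\<^sub>C y) = c *\<^sub>C (x * y)"
    and norm_scaleC: "norm (c *\<^sub>C x) = cmod c * norm x"

instantiation complex :: complex_banach_algebra_1
begin

definition scaleC_complex :: "complex \<Rightarrow> complex \<Rightarrow> complex" where
  "scaleC_complex c x = c * x"

instance
  by standard (simp_all add: scaleC_complex_def scaleR_conv_of_real algebra_simps norm_mult)

end

text \<open>No continuity or norm condition is imposed on the involution.\<close>

definition involution :: "('a::complex_banach_algebra_1 \<Rightarrow> 'a) \<Rightarrow> bool" where
  "involution star \<longleftrightarrow>
     (\<forall>x y. star (x + y) = star x + star y) \<and>
     (\<forall>c x. star (c *\<^sub>C x) = cnj c *\<^sub>C star x) \<and>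
     (\<forall>x y. star (x * y) = star y * star x) \<and>
     (\<forall>x. star (star x) = x)"

definition quasinilpotent :: "'a::real_normed_algebra_1 \<Rightarrow> bool" where
  "quasinilpotent u \<longleftrightarrow> (\<lambda>n. root n (norm (u ^ n))) \<longlonglongrightarrow> 0"

definition w_EP_inverse ::
    "('a::complex_banach_algebra_1 \<Rightarrow> 'a) \<Rightarrow> 'a \<Rightarrow> 'a \<Rightarrow> 'a \<Rightarrow> bool" where
  "w_EP_inverse star w a x \<longleftrightarrow>
     a * (w * x)\<^sup>2 = x \<and>
     x * (w * a)\<^sup>2 = a \<and>
     star (a * w * x * w) = a * w * x * w \<and>
     star (x * w * a * w) = x * w * a * w"

definition w_EP_element ::
    "('a::complex_banach_algebra_1 \<Rightarrow> 'a) \<Rightarrow> 'a \<Rightarrow> 'a \<Rightarrow> bool" where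
  "w_EP_element star w a \<longleftrightarrow> (\<exists>x. w_EP_inverse star w a x)"

definition generalized_w_EP_inverse ::
    "('a::complex_banach_algebra_1 \<Rightarrow> 'a) \<Rightarrow> 'a \<Rightarrow> 'a \<Rightarrow> 'a \<Rightarrow> bool" where
  "generalized_w_EP_inverse star w a x \<longleftrightarrow>
     a * (w * x)\<^sup>2 = x \<and>
     star (a * w * x * w) = a * w * x * w \<and>
     star (x * w * a * w) = x * w * a * w \<and>
     (\<lambda>n. root n (norm ((a * w) ^ n - x * w * (a * w) ^ (n + 1)))) \<longlonglongrightarrow> 0"

definition generalized_w_EP_element ::
    "('a::complex_banach_algebra_1 \<Rightarrow> 'a) \<Rightarrow> 'a \<Rightarrow> 'a \<Rightarrow> bool" where
  "generalized_w_EP_element star w a \<longleftrightarrow> (\<exists>x. generalized_w_EP_inverse star w a x)"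

definition generalized_w_Drazin_inverse ::
    "'a::complex_banach_algebra_1 \<Rightarrow> 'a \<Rightarrow> 'a \<Rightarrow> bool" where
  "generalized_w_Drazin_inverse w a x \<longleftrightarrow>
     a * w * x = x * w * a \<and>
     x * w * a * w * x = x \<and>
     quasinilpotent ((a - a * w * x * w * a) * w)"

definition has_generalized_w_Drazin_inverse ::
    "'a::complex_banach_algebra_1 \<Rightarrow> 'a \<Rightarrow> bool" where
  "has_generalized_w_Drazin_inverse w a \<longleftrightarrow> (\<exists>x. generalized_w_Drazin_inverse w a x)"

text \<open>
  The element $a^{d,w}$; generalized $w$-Drazin inverses are unique, so the description is
  meaningful exactly when \<^prop>\<open>has_generalized_w_Drazin_inverse w a\<close> holds.
\<close>

definition gwD :: "'a::complex_banach_algebra_1 \<Rightarrow> 'a \<Rightarrow> 'a" where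
  "gwD w a = (THE x. generalized_w_Drazin_inverse w a x)"

end

theory Submission
  imports Defs
begin

text \<open>
  Put \<open>A = a w\<close> and \<open>X = x w\<close>. If \<open>x\<close> is a generalized \<open>w\<close>-EP inverse of \<open>a\<close>, then
  \<open>p = A X = A\<^sup>n X\<^sup>n\<close> for \<open>n > 0\<close>, so \<open>A X - X A\<^sup>2 X = (A\<^sup>n - X A\<^bsup>n+1\<^esup>) X\<^sup>n\<close> and its norm is at most
  \<open>\<epsilon>\<^sub>n\<^sup>n \<parallel>X\<parallel>\<^sup>n\<close> with \<open>\<epsilon>\<^sub>n \<rightarrow> 0\<close>, that is, \<open>A X = X A\<^sup>2 X\<close>. Hence the self-adjoint elements \<open>p\<close> and \<open>q = X A\<close>
  satisfy \<open>q p = p\<close> and \<open>p q = q\<close>, and taking adjoints gives \<open>p = q\<close>. So \<open>X\<close> commutes with \<open>A\<close>, it is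
  the generalized Drazin inverse of \<open>A\<close>, and \<open>a\<^bsup>d,w\<^esup> = X\<^sup>2 a\<close>.

  Conversely, for a \<open>w\<close>-EP inverse \<open>y\<close> of \<open>d = a\<^bsup>d,w\<^esup>\<close> the same adjoint argument shows that \<open>y w\<close> and
  \<open>d w\<close> commute, and \<open>x = (d w)\<^sup>2 y\<close> has \<open>x w = d w\<close>.
\<close>

text \<open>As in the root test, \<open>norm (f n)\<close> eventually lies below
  \<open>e ^ n\<close> for every \<open>e > 0\<close>, which beats the geometric growth of
  \<open>K ^ n\<close>.\<close>

lemma eq_zero_if_root_tendsto_zero:
  fixes z :: "'a::real_normed_vector" and f :: "nat \<Rightarrow> 'b::real_normed_vector"
  assumes lim: "(\<lambda>n. root n (norm (f n))) \<longlonglongrightarrow> 0"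
    and le: "\<And>n. n > 0 \<Longrightarrow> norm z \<le> norm (f n) * K ^ n"
    and "K \<ge> 0"
  shows "z = 0"
proof -
  \<comment> \<open>This choice forces \<open>e * K \<le> 1 / 2\<close>; the summand
    \<open>1\<close> keeps the denominator positive when \<open>K = 0\<close>.\<close>
  define e where "e = 1 / (2 * (K + 1))"
  have "e > 0" using \<open>K \<ge> 0\<close> by (simp add: e_def)
  have eK: "e * K \<le> 1 / 2" "0 \<le> e * K"
    using \<open>K \<ge> 0\<close> by (simp_all add: e_def divide_simps)
  have "eventually (\<lambda>n. root n (norm (f n)) < e) sequentially"
    using order_tendstoD(2)[OF lim \<open>e > 0\<close>] .
  then have "eventually (\<lambda>n. norm z \<le> (1 / 2) ^ n) sequentially"
    using eventually_gt_at_top[of 0]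
  proof eventually_elim
    case (elim n)
    have "norm (f n) = root n (norm (f n)) ^ n"
      using elim by simp
    also have "\<dots> \<le> e ^ n"
      using elim by (intro power_mono) auto
    finally have "norm (f n) * K ^ n \<le> e ^ n * K ^ n"
      using \<open>K \<ge> 0\<close> by (intro mult_right_mono) auto
    also have "\<dots> \<le> (1 / 2) ^ n"
      using eK by (simp add: power_mono flip: power_mult_distrib)
    finally show ?case
      using le[of n] elim by simp
  qed
  moreover have "(\<lambda>n. (1 / 2 :: real) ^ n) \<longlonglongrightarrow> 0"
    by (rule LIMSEQ_power_zero) simp
  ultimately have "norm z \<le> 0"
    by (intro tendsto_lowerbound[of "\<lambda>n. (1 / 2 :: real) ^ n"]) auto
  then show ?thesis by simp
qed

text \<open>\<open>A * D\<close> is an idempotent commuting with \<open>A\<close>, so the left side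
  is \<open>A ^ n * (1 - A * D)\<close>. At \<open>n = 0\<close> this fails in general, since the
  left side is then \<open>1\<close>.\<close>

lemma power_diff_mult_commuting:
  fixes A D :: "'a::ring_1"
  assumes comm: "A * D = D * A" and inner: "D * A * D = D" and "n > 0"
  shows "(A - A * D * A) ^ n = A ^ n - D * A ^ (n + 1)"
  using \<open>n > 0\<close>
proof (induction n rule: nat_induct_non_zero)
  case 1
  show ?case by (simp add: comm mult.assoc)
next
  case (Suc n)
  have "D * A * (A * D) = A * D"
    by (metis comm inner mult.assoc)
  moreover have "A ^ n * D = D * A ^ n"
    using power_commuting_commutes[OF comm] .
  moreover have "(A ^ n - D * A ^ (n + 1)) * (A - A * D * A)
      = A ^ n * A - D * A ^ n * A * A - A ^ n * (A * D) * A + D * A ^ n * A * (A * D) * A"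
    by (simp add: algebra_simps power_commutes)
  moreover have "D * A ^ n * A * (A * D) * A = A ^ n * (D * A * (A * D)) * A"
    by (simp only: calculation(2)[symmetric] mult.assoc)
  ultimately have "(A ^ n - D * A ^ (n + 1)) * (A - A * D * A) = A ^ n * A - D * A ^ n * A * A"
    by (simp add: algebra_simps)
  then show ?case
    unfolding power_Suc2[of "A - A * D * A"] Suc.IH by (simp add: mult.assoc power_commutes)
qed

text \<open>Links the limit condition on generalized \<open>w\<close>-EP inverses with
  quasinilpotency in the Drazin setting: the two sequences agree for \<open>n > 0\<close>.\<close>

lemma quasinilpotent_iff_root_tendsto:
  fixes A D :: "'a::real_normed_algebra_1"
  assumes "A * D = D * A" "D * A * D = D"
  shows "quasinilpotent (A - A * D * A) \<longleftrightarrow>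
    (\<lambda>n. root n (norm (A ^ n - D * A ^ (n + 1)))) \<longlonglongrightarrow> 0"
  unfolding quasinilpotent_def
proof (rule tendsto_cong)
  show "\<forall>\<^sub>F n in sequentially.
      root n (norm ((A - A * D * A) ^ n)) = root n (norm (A ^ n - D * A ^ (n + 1)))"
    using eventually_gt_at_top[of 0]
    by eventually_elim (simp only: power_diff_mult_commuting[OF assms])
qed

lemma power_mult_power_eq:
  fixes A X :: "'a::monoid_mult"
  assumes "A * X * X = X" and "n > 0"
  shows "A ^ n * X ^ n = A * X"
  using \<open>n > 0\<close>
proof (induction n rule: nat_induct_non_zero)
  case (Suc n)
  \<comment> \<open>With \<open>n = Suc m\<close> the power \<open>X ^ Suc n\<close> has at least
    two factors, so \<open>A * X * X = X\<close> can absorb the innermost \<open>A\<close>.\<close>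
  obtain m where m: "n = Suc m" using Suc.hyps gr0_conv_Suc by blast
  have "A * X ^ Suc (Suc m) = X ^ Suc m"
    using assms(1) by (simp flip: mult.assoc)
  then have "A ^ Suc n * X ^ Suc n = A ^ n * X ^ n"
    unfolding m power_Suc2[of A "Suc m"] by (simp only: mult.assoc)
  then show ?case using Suc.IH by simp
qed simp

text \<open>The difference of the two sides equals \<open>(A ^ n - E * A ^ (n + 1)) * X ^ n\<close>
  for every \<open>n > 0\<close>. Keeping \<open>E\<close> apart from \<open>X\<close> allows two
  different candidate inverses to be compared.\<close>

lemma mult_eq_mult_if_root_tendsto_zero:
  fixes A X E :: "'a::real_normed_algebra_1"
  assumes "A * X * X = X"
    and lim: "(\<lambda>n. root n (norm (A ^ n - E * A ^ (n + 1)))) \<longlonglongrightarrow> 0"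
  shows "E * A * (A * X) = A * X"
proof -
  have "A * X - E * A * (A * X) = 0"
  proof (rule eq_zero_if_root_tendsto_zero[OF lim])
    fix n :: nat assume "n > 0"
    have "(A ^ n - E * A ^ (n + 1)) * X ^ n = A ^ n * X ^ n - E * A * (A ^ n * X ^ n)"
      by (simp add: algebra_simps)
    then have eq: "A * X - E * A * (A * X) = (A ^ n - E * A ^ (n + 1)) * X ^ n"
      by (simp only: power_mult_power_eq[OF assms(1) \<open>n > 0\<close>])
    have "norm (A * X - E * A * (A * X)) \<le> norm (A ^ n - E * A ^ (n + 1)) * norm (X ^ n)"
      unfolding eq by (rule norm_mult_ineq)
    also have "\<dots> \<le> norm (A ^ n - E * A ^ (n + 1)) * norm X ^ n"
      by (intro mult_left_mono norm_power_ineq norm_ge_zero)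
    finally show "norm (A * X - E * A * (A * X)) \<le> norm (A ^ n - E * A ^ (n + 1)) * norm X ^ n" .
  qed simp
  then show ?thesis by simp
qed

text \<open>For the idempotents \<open>A * D\<close> and \<open>A * E\<close>, the product
  \<open>A * D * (A * E)\<close> equals both of them. Hence they coincide, and this common
  idempotent forces \<open>D = E\<close>.\<close>

lemma gDrazin_inverse_unique:
  fixes A D E :: "'a::real_normed_algebra_1"
  assumes D: "A * D = D * A" "D * A * D = D" "quasinilpotent (A - A * D * A)"
    and E: "A * E = E * A" "E * A * E = E" "quasinilpotent (A - A * E * A)"
  shows "D = E"
proof -
  have ADD: "A * D * D = D" using D(1,2) by simp
  have "D * A * (A * E) = A * E"
    using mult_eq_mult_if_root_tendsto_zero[of A E D] D E quasinilpotent_iff_root_tendsto[of A D]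
    by simp
  \<comment> \<open>The mirror image of the previous estimate: powers of \<open>D\<close> now
    multiply from the left.\<close>
  moreover have "A * D - A * D * (A * E) = 0"
  proof (rule eq_zero_if_root_tendsto_zero)
    show "(\<lambda>n. root n (norm (A ^ n - E * A ^ (n + 1)))) \<longlonglongrightarrow> 0"
      using E quasinilpotent_iff_root_tendsto[of A E] by simp
    fix n :: nat assume "n > 0"
    have "A ^ n * D ^ n = D ^ n * A ^ n"
      by (intro power_commuting_commutes[symmetric] power_commuting_commutes D(1))
    then have DA: "D ^ n * A ^ n = A * D"
      using power_mult_power_eq[OF ADD \<open>n > 0\<close>] by simp
    have "E * A ^ (n + 1) = A ^ n * (A * E)"
      using power_commuting_commutes[OF E(1), of "n + 1"]
      by (metis mult.assoc power_Suc2 Suc_eq_plus1)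
    then have "D ^ n * (A ^ n - E * A ^ (n + 1)) = D ^ n * A ^ n - D ^ n * A ^ n * (A * E)"
      by (simp only: right_diff_distrib mult.assoc)
    then have eq: "A * D - A * D * (A * E) = D ^ n * (A ^ n - E * A ^ (n + 1))"
      by (simp only: DA)
    have "norm (A * D - A * D * (A * E)) \<le> norm (D ^ n) * norm (A ^ n - E * A ^ (n + 1))"
      unfolding eq by (rule norm_mult_ineq)
    also have "\<dots> \<le> norm D ^ n * norm (A ^ n - E * A ^ (n + 1))"
      by (intro mult_right_mono norm_power_ineq norm_ge_zero)
    finally show "norm (A * D - A * D * (A * E)) \<le> norm (A ^ n - E * A ^ (n + 1)) * norm D ^ n"
      by (simp only: mult.commute)
  qed simp
  ultimately have eq: "A * D = A * E" using D(1) by simp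
  have "D = D * (A * D)" using D(2) by (simp add: mult.assoc)
  also have "\<dots> = D * A * E" by (simp only: eq mult.assoc)
  also have "\<dots> = A * E * E" using D(1) eq by simp
  also have "\<dots> = E" using E(1,2) by simp
  finally show ?thesis .
qed

text \<open>Reduces the weighted notion to the ordinary one for \<open>a * w\<close> and
  \<open>d * w\<close>. The last identity recovers \<open>d\<close> from \<open>d * w\<close>, so
  uniqueness carries over.\<close>

lemma generalized_w_Drazin_inverse_mult:
  assumes "generalized_w_Drazin_inverse w a d"
  shows "(a * w) * (d * w) = (d * w) * (a * w)"
    and "(d * w) * (a * w) * (d * w) = d * w"
    and "quasinilpotent (a * w - (a * w) * (d * w) * (a * w))"
    and "d = (d * w) * (d * w) * a"
  using assms unfolding generalized_w_Drazin_inverse_def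
  by (simp_all add: left_diff_distrib mult.assoc) (metis mult.assoc)+

lemma generalized_w_Drazin_inverse_unique:
  assumes "generalized_w_Drazin_inverse w a d" "generalized_w_Drazin_inverse w a e"
  shows "d = e"
proof -
  note d = generalized_w_Drazin_inverse_mult[OF assms(1)]
  note e = generalized_w_Drazin_inverse_mult[OF assms(2)]
  have "d * w = e * w"
    using gDrazin_inverse_unique[OF d(1-3) e(1-3)] .
  then show ?thesis
    using d(4) e(4) by simp
qed

lemma gwD_eq: "generalized_w_Drazin_inverse w a d \<Longrightarrow> gwD w a = d"
  unfolding gwD_def by (blast intro: generalized_w_Drazin_inverse_unique)

lemma commute_if_self_adjoint_products:
  assumes "involution star"
    and "star (A * X) = A * X" "star (X * A) = X * A"
    and "A * X * X = X" "X * A * (A * X) = A * X"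
  shows "A * X = X * A"
proof -
  have pq: "A * X * (X * A) = X * A"
    using assms(4) by (simp flip: mult.assoc)
  have "X * A = star (A * X * (X * A))"
    using pq assms(3) by simp
  also have "\<dots> = X * A * (A * X)"
    using assms(1-3) by (simp add: involution_def)
  finally show ?thesis using assms(5) by simp
qed

lemma generalized_w_EP_inverse_imp_gwD:
  assumes "involution star" and "generalized_w_EP_inverse star w a x"
  shows "generalized_w_Drazin_inverse w a ((x * w)\<^sup>2 * a)" (is ?drazin)
    and "w_EP_inverse star w ((x * w)\<^sup>2 * a) ((a * w)\<^sup>2 * x)" (is ?EP)
proof -
  define A X where "A = a * w" and "X = x * w"
  have x: "A * X * x = x" and p: "star (A * X) = A * X" "star (X * A) = X * A"
    and lim: "(\<lambda>n. root n (norm (A ^ n - X * A ^ (n + 1)))) \<longlonglongrightarrow> 0"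
    using assms(2) unfolding generalized_w_EP_inverse_def A_def X_def
    by (simp_all add: power2_eq_square mult.assoc)
  have AXX: "A * X * X = X"
    using x by (metis X_def mult.assoc)
  have comm: "A * X = X * A"
    using commute_if_self_adjoint_products[OF assms(1) p AXX]
      mult_eq_mult_if_root_tendsto_zero[OF AXX lim] by blast
  have XAX: "X * A * X = X" using AXX comm by simp
  have qn: "quasinilpotent (A - A * X * A)"
    using quasinilpotent_iff_root_tendsto[OF comm XAX] lim by blast
  \<comment> \<open>As rewrite rules on right-nested products, these move each \<open>A\<close> left
    past \<open>X\<close> and then cancel.\<close>
  have AXX': "A * (X * (X * z)) = X * z" and comm': "X * (A * z) = A * (X * z)"
    and x': "A * (X * x) = x" for z
    using AXX comm x by (metis mult.assoc)+
  \<comment> \<open>Here \<open>d * w\<close> is \<open>X * X * A = X\<close>, and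
    \<open>y * w\<close> is its inverse in the corner of the idempotent
    \<open>A * X\<close>.\<close>
  define d y where "d = X * (X * a)" and "y = A * (A * x)"
  have dw: "d * w = X" and yw: "y * w = A * (A * X)"
    using AXX' comm' comm by (simp_all add: d_def y_def A_def[symmetric] X_def[symmetric] mult.assoc)
      (metis AXX mult.assoc)
  have aw: "a * (w * z) = A * z" and dw': "d * (w * z) = X * z"
    and yw': "y * (w * z) = A * (A * (X * z))" for z
    using A_def dw yw by (metis mult.assoc)+
  have "a * w * d = d * w * a"
    by (simp add: mult.assoc aw dw') (simp add: d_def AXX')
  moreover have "d * w * a * w * d = d"
    by (simp add: mult.assoc aw dw') (simp add: d_def AXX' comm')
  moreover have "(a - a * w * d * w * a) * w = A - A * X * A"
    by (simp add: left_diff_distrib mult.assoc aw dw' A_def[symmetric])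
  ultimately show ?drazin
    using qn by (simp add: generalized_w_Drazin_inverse_def d_def power2_eq_square X_def mult.assoc)
  have "d * (w * y)\<^sup>2 = y"
    by (simp add: power2_eq_square mult.assoc dw' yw') (simp add: y_def comm' AXX' x')
  moreover have "y * (w * d)\<^sup>2 = d"
    by (simp add: power2_eq_square mult.assoc dw' yw') (simp add: d_def comm' AXX')
  moreover have "d * w * y * w = A * X" "y * w * d * w = A * X"
    by (simp_all add: mult.assoc dw dw' yw yw') (metis AXX comm comm' mult.assoc)+
  ultimately have "w_EP_inverse star w d y"
    using p by (simp add: w_EP_inverse_def)
  then show ?EP
    by (simp add: d_def y_def power2_eq_square X_def A_def mult.assoc)
qed

lemma w_EP_inverse_imp_generalized_w_EP_inverse:
  assumes "involution star" and "generalized_w_Drazin_inverse w a d"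
    and "w_EP_inverse star w d y"
  shows "generalized_w_EP_inverse star w a ((d * w)\<^sup>2 * y)"
proof -
  define A D Y where "A = a * w" and "D = d * w" and "Y = y * w"
  note d = generalized_w_Drazin_inverse_mult[OF assms(2), folded A_def D_def]
  have y: "D * Y * y = y" and d': "Y * D * d = d"
    and p: "star (D * Y) = D * Y" "star (Y * D) = Y * D"
    using assms(3) unfolding w_EP_inverse_def D_def Y_def
    by (simp_all add: power2_eq_square mult.assoc)
  have DYY: "D * Y * Y = Y" and YDD: "Y * D * D = D"
    using y d' by (metis D_def Y_def mult.assoc)+
  have comm: "D * Y = Y * D"
    using commute_if_self_adjoint_products[OF assms(1) p DYY] YDD by (simp flip: mult.assoc)
  have ADD: "A * D * D = D" using d(1,2) by simp
  define x where "x = D * (D * y)"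
  \<comment> \<open>By commutation \<open>D * D * Y = Y * D * D = D\<close>.\<close>
  have xw: "x * w = D"
    using comm YDD unfolding x_def Y_def by (metis mult.assoc)
  have aw: "a * (w * z) = A * z" and xw': "x * (w * z) = D * z" for z
    using A_def xw by (metis mult.assoc)+
  have ADD': "A * (D * (D * z)) = D * z" for z
    using ADD by (metis mult.assoc)
  have "a * (w * x)\<^sup>2 = x"
    by (simp add: power2_eq_square mult.assoc aw xw') (simp add: x_def ADD')
  \<comment> \<open>This carries self-adjointness over from \<open>D * Y\<close>: insert
    \<open>D = D * (D * Y)\<close>, then cancel with \<open>A * D * D = D\<close>.\<close>
  moreover have "A * D = D * Y"
  proof -
    have "A * D = A * D * (D * Y)"
      using YDD comm by (metis mult.assoc)
    then show ?thesis using ADD by (simp flip: mult.assoc)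
  qed
  moreover have "a * w * x * w = A * D" "x * w * a * w = A * D"
    using d(1) by (simp_all add: mult.assoc xw aw A_def[symmetric])
  moreover have "(\<lambda>n. root n (norm (A ^ n - D * A ^ (n + 1)))) \<longlonglongrightarrow> 0"
    using quasinilpotent_iff_root_tendsto[OF d(1,2)] d(3) by blast
  ultimately have "generalized_w_EP_inverse star w a x"
    using p(1) by (simp add: generalized_w_EP_inverse_def xw A_def)
  then show ?thesis
    by (simp add: x_def D_def power2_eq_square mult.assoc)
qed

theorem theorem4p1:
  fixes star :: "'a::complex_banach_algebra_1 \<Rightarrow> 'a" and a w :: 'a
  assumes "involution star"
  shows "(generalized_w_EP_element star w a \<longleftrightarrow>
            has_generalized_w_Drazin_inverse w a \<and> w_EP_element star w (gwD w a)) \<and>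
         (generalized_w_EP_element star w a \<longrightarrow>
            (\<forall>x. generalized_w_EP_inverse star w a x \<longrightarrow>
               w_EP_inverse star w (gwD w a) ((a * w)\<^sup>2 * x)) \<and>
            (\<forall>y. w_EP_inverse star w (gwD w a) y \<longrightarrow>
               generalized_w_EP_inverse star w a ((gwD w a * w)\<^sup>2 * y)))"
proof -
  have fwd: "has_generalized_w_Drazin_inverse w a" "w_EP_inverse star w (gwD w a) ((a * w)\<^sup>2 * x)"
    if "generalized_w_EP_inverse star w a x" for x
    using generalized_w_EP_inverse_imp_gwD[OF assms that] gwD_eq
    unfolding has_generalized_w_Drazin_inverse_def by (blast, metis)
  have bwd: "generalized_w_EP_inverse star w a ((gwD w a * w)\<^sup>2 * y)"
    if "has_generalized_w_Drazin_inverse w a" "w_EP_inverse star w (gwD w a) y" for y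
    using w_EP_inverse_imp_generalized_w_EP_inverse[OF assms _ that(2)] that(1) gwD_eq
    unfolding has_generalized_w_Drazin_inverse_def by metis
  show ?thesis
    using fwd bwd unfolding generalized_w_EP_element_def w_EP_element_def by blast
qed

end
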